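(* Let $n_s,n_t,C\ge 1$, let $\zeta=(\zeta_{ij})\in\mathbb{R}_+^{n_s\times n_t}$, $\eta>0$, let $y^s_1,\dots,y^s_{n_s}\in\{1,\dots,C\}$ be source labels, and let $\mu^t\in\Sigma_{n_t}$ be a fixed probability vector. Let $D=(d_{ic})\in\mathbb{R}_+^{n_s\times C}$ be given by $d_{ic}=1/n_s^c$ if $y^s_i=c$ and $d_{ic}=0$ otherwise, where $n_s^c=\#\{i: y_i^s=c\}$, and let $\Delta_C=\{\alpha\in\mathbb{R}_+^C:\sum_{c=1}^C\sum_{i=1}^{n_s}d_{ic}\alpha_c=1\}$. Consider the problem, in which both the transport plan $\gamma$ and the class-proportion vector $\nu$ are optimized, $$\min_{\substack{\gamma\in\Pi(D\nu,\mu^t)\\ \nu\in\Delta_C}}\{\langle\zeta,\gamma\rangle_F-\eta H(\gamma)\}.$$ The dual of this problem writes as $$(f^\star,g^\star)=\operatorname*{arg\,min}_{f\in\mathbb{R}^{n_s},\,g\in\mathbb{R}^{n_t}}\Big\{\mathbf 1_{n_s}^\top B(f,g)\mathbf 1_{n_t}-\langle g,\mu^t\rangle+\chi_{\mathcal F}(f)\Big\},$$ where $\mathcal F=\big\{f\in\mathbb{R}^{n_s}:\sum_{i=1}^{n_s}(f_i+1)d_{ic}=0,\ \forall c=1,\dots,C\big\}$, and $\chi_{\mathcal F}(f)=0$ if $f\in\mathcal F$, $\chi_{\mathcal F}(f)=\infty$ otherwise.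
   Context: Notation. $\mathbf 1_n\in\mathbb{R}^n$ is the all-ones vector. $\Sigma_n=\{\omega\in\mathbb{R}^n_+:\sum_{j=1}^n\omega_j=1\}$ is the probability simplex. For $\mu\in\mathbb{R}_+^{n_s}$ and $\mu'\in\mathbb{R}_+^{n_t}$, $\Pi(\mu,\mu')=\{\gamma\in\mathbb{R}_+^{n_s\times n_t}:\gamma\mathbf 1_{n_t}=\mu,\ \gamma^\top\mathbf 1_{n_s}=\mu'\}$. $\langle T,W\rangle_F=\sum_{i,j}T_{ij}W_{ij}$ is the Frobenius product. $H(\gamma)=-\sum_{i=1}^{n_s}\sum_{j=1}^{n_t}\gamma_{ij}\log\gamma_{ij}$ (with $0\log 0=0$). $K=e^{-\zeta/\eta}$ is the entrywise exponential, i.e. $K_{ij}=e^{-\zeta_{ij}/\eta}$, and $B(f,g)=\mathrm{diag}(e^{f})\,K\,\mathrm{diag}(e^{g})$, i.e. $B(f,g)_{ij}=e^{f_i}K_{ij}e^{g_j}$. Meaning of "dual problem". It is the Lagrangian dual of the primal problem with respect to the constraints $\gamma\mathbf 1_{n_t}=D\nu$ (multiplier $\lambda\in\mathbb{R}^{n_s}$), $\gamma^\top\mathbf 1_{n_s}=\mu^t$ (multiplier $\beta\in\mathbb{R}^{n_t}$), and the constraint $\nu\in\Delta_C$. It is written in variables $f,g$ that are, up to opposite shifts by a common constant, $-\lambda/\eta-\tfrac12\mathbf 1_{n_s}$ and $-\beta/\eta-\tfrac12\mathbf 1_{n_t}$. The Lagrangian dual maximization problem is written as a minimization by dropping the overall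 factor $-\eta$: the dual objective to be maximized is $-\eta$ times the displayed objective, so the optimal value of the Lagrangian dual is $-\eta$ times the infimum of the displayed objective. *)

theory Defs
  imports "HOL-Analysis.Analysis"
begin

section \<open>Lagrangian duality\<close>

text \<open>The problem: minimise \<open>J x\<close> over \<open>x \<in> X\<close> subject to \<open>h x = 0\<close> and \<open>k x \<le> 0\<close>.
  The multipliers form a pair: \<open>l\<close> (free) for \<open>h x = 0\<close> and \<open>r\<close> (with \<open>0 \<le> r\<close>) for \<open>k x \<le> 0\<close>.\<close>

definition feasible_set :: "'x set \<Rightarrow> ('x \<Rightarrow> 'e::zero) \<Rightarrow> ('x \<Rightarrow> 'i::{zero,ord}) \<Rightarrow> 'x set" where
  "feasible_set X h k = {x \<in> X. h x = 0 \<and> k x \<le> 0}"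

definition lagrangian ::
    "('x \<Rightarrow> real) \<Rightarrow> ('x \<Rightarrow> 'e::real_inner) \<Rightarrow> ('x \<Rightarrow> 'i::real_inner) \<Rightarrow> 'x \<Rightarrow> 'e \<times> 'i \<Rightarrow> real" where
  "lagrangian J h k x = (\<lambda>(l, r). J x + l \<bullet> h x + r \<bullet> k x)"

definition lagrange_dual ::
    "'x set \<Rightarrow> ('x \<Rightarrow> real) \<Rightarrow> ('x \<Rightarrow> 'e::real_inner) \<Rightarrow> ('x \<Rightarrow> 'i::real_inner) \<Rightarrow> 'e \<times> 'i \<Rightarrow> ereal" where
  "lagrange_dual X J h k m = (INF x\<in>X. ereal (lagrangian J h k x m))"

definition dual_feasible :: "'e \<times> 'i::{zero,ord} \<Rightarrow> bool" where
  "dual_feasible m \<longleftrightarrow> 0 \<le> snd m"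


section \<open>The primal problem\<close>

text \<open>Index types: \<open>'s\<close> (source points), \<open>'t\<close> (target points), \<open>'c\<close> (classes). The constant
  vector \<open>1\<close> is the all-ones vector, and \<open>\<le>\<close> on vectors and matrices is entrywise.\<close>

definition prob_simplex :: "(real ^ 'n) set" where
  "prob_simplex = {w. 0 \<le> w \<and> (\<Sum>j\<in>UNIV. w $ j) = 1}"

definition couplings :: "real ^ 's \<Rightarrow> real ^ 't \<Rightarrow> (real ^ 't ^ 's) set" where
  "couplings \<mu> \<mu>' = {\<gamma>. 0 \<le> \<gamma> \<and> \<gamma> *v 1 = \<mu> \<and> transpose \<gamma> *v 1 = \<mu>'}"

definition frobenius :: "real ^ 't ^ 's \<Rightarrow> real ^ 't ^ 's \<Rightarrow> real" where
  "frobenius T W = (\<Sum>i\<in>UNIV. \<Sum>j\<in>UNIV. T $ i $ j * W $ i $ j)"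

text \<open>Since \<open>ln 0 = 0\<close> in the library, the convention \<open>0 log 0 = 0\<close> holds.\<close>

definition entropy :: "real ^ 't ^ 's \<Rightarrow> real" where
  "entropy \<gamma> = - (\<Sum>i\<in>UNIV. \<Sum>j\<in>UNIV. \<gamma> $ i $ j * ln (\<gamma> $ i $ j))"

text \<open>Classes without any source point are allowed; their column is zero.\<close>

definition class_matrix :: "('s::finite \<Rightarrow> 'c::finite) \<Rightarrow> real ^ 'c ^ 's" where
  "class_matrix y = (\<chi> i c. if y i = c then 1 / real (card {i'. y i' = c}) else 0)"

definition class_proportions :: "('s::finite \<Rightarrow> 'c::finite) \<Rightarrow> (real ^ 'c) set" where
  "class_proportions y =
     {\<alpha>. 0 \<le> \<alpha> \<and> (\<Sum>c\<in>UNIV. \<Sum>i\<in>UNIV. class_matrix y $ i $ c * \<alpha> $ c) = 1}"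

definition primal_set ::
    "('s::finite \<Rightarrow> 'c::finite) \<Rightarrow> real ^ 't \<Rightarrow> ((real ^ 't ^ 's) \<times> (real ^ 'c)) set" where
  "primal_set y \<mu> =
     {(\<gamma>, \<nu>). \<nu> \<in> class_proportions y \<and> \<gamma> \<in> couplings (class_matrix y *v \<nu>) \<mu>}"

definition primal_cost ::
    "real ^ 't ^ 's \<Rightarrow> real \<Rightarrow> (real ^ 't ^ 's) \<times> (real ^ 'c) \<Rightarrow> real" where
  "primal_cost \<zeta> \<eta> = (\<lambda>(\<gamma>, \<nu>). frobenius \<zeta> \<gamma> - \<eta> * entropy \<gamma>)"


section \<open>Its Lagrangian dual\<close>

text \<open>Only \<open>0 \<le> \<gamma>\<close>, the domain of the entropy, is kept as an implicit constraint; \<open>\<nu>\<close> ranges over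
  the whole space. The constraint \<open>\<nu> \<in> class_proportions y\<close> is dualised through its two parts,
  the normalisation (last component below) and the sign condition.\<close>

definition primal_domain :: "((real ^ 't ^ 's) \<times> (real ^ 'c)) set" where
  "primal_domain = {(\<gamma>, \<nu>). 0 \<le> \<gamma>}"

definition primal_eq ::
    "('s::finite \<Rightarrow> 'c::finite) \<Rightarrow> real ^ 't \<Rightarrow> (real ^ 't ^ 's) \<times> (real ^ 'c)
       \<Rightarrow> (real ^ 's) \<times> (real ^ 't) \<times> real" where
  "primal_eq y \<mu> = (\<lambda>(\<gamma>, \<nu>).
     (\<gamma> *v 1 - class_matrix y *v \<nu>,
      transpose \<gamma> *v 1 - \<mu>,
      (\<Sum>c\<in>UNIV. \<Sum>i\<in>UNIV. class_matrix y $ i $ c * \<nu> $ c) - 1))"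

definition primal_ineq :: "(real ^ 't ^ 's) \<times> (real ^ 'c) \<Rightarrow> real ^ 'c" where
  "primal_ineq = (\<lambda>(\<gamma>, \<nu>). - \<nu>)"

text \<open>The argument has the form \<open>((\<lambda>, \<beta>, \<kappa>), \<rho>)\<close>.\<close>

definition dual_fun ::
    "real ^ 't ^ 's \<Rightarrow> real \<Rightarrow> ('s::finite \<Rightarrow> 'c::finite) \<Rightarrow> real ^ 't
       \<Rightarrow> ((real ^ 's) \<times> (real ^ 't) \<times> real) \<times> (real ^ 'c) \<Rightarrow> ereal" where
  "dual_fun \<zeta> \<eta> y \<mu> =
     lagrange_dual primal_domain (primal_cost \<zeta> \<eta>) (primal_eq y \<mu>) primal_ineq"


section \<open>The dual in the variables \<open>f\<close> and \<open>g\<close>\<close>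

definition scaled_kernel ::
    "real ^ 't ^ 's \<Rightarrow> real \<Rightarrow> real ^ 's \<Rightarrow> real ^ 't \<Rightarrow> real ^ 't ^ 's" where
  "scaled_kernel \<zeta> \<eta> f g = (\<chi> i j. exp (f $ i) * exp (- (\<zeta> $ i $ j) / \<eta>) * exp (g $ j))"

definition chi_fun :: "'a set \<Rightarrow> 'a \<Rightarrow> ereal" where
  "chi_fun S x = (if x \<in> S then 0 else \<infinity>)"

definition potential_set :: "('s::finite \<Rightarrow> 'c::finite) \<Rightarrow> (real ^ 's) set" where
  "potential_set y = {f. \<forall>c. (\<Sum>i\<in>UNIV. (f $ i + 1) * class_matrix y $ i $ c) = 0}"

definition fg_objective ::
    "real ^ 't ^ 's \<Rightarrow> real \<Rightarrow> ('s::finite \<Rightarrow> 'c::finite) \<Rightarrow> real ^ 't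
       \<Rightarrow> (real ^ 's) \<times> (real ^ 't) \<Rightarrow> ereal" where
  "fg_objective \<zeta> \<eta> y \<mu> = (\<lambda>(f, g).
     ereal (1 \<bullet> (scaled_kernel \<zeta> \<eta> f g *v 1) - g \<bullet> \<mu>) + chi_fun (potential_set y) f)"

text \<open>The change of variables: \<open>f = - \<lambda>/\<eta> - 1/2\<close> and \<open>g = - \<beta>/\<eta> - 1/2\<close> up to opposite shifts by
  the constant \<open>\<kappa>/\<eta> - 1/2\<close>. Minimising the Lagrangian over \<open>\<nu>\<close> at \<open>\<rho> = 0\<close> forces
  \<open>(\<Sum>i. d i c * \<lambda> i) = \<kappa> * (\<Sum>i. d i c)\<close> for every class \<open>c\<close>, and this shift turns that
  condition into membership in \<open>potential_set\<close>.\<close>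

definition potentials ::
    "real \<Rightarrow> (real ^ 's) \<times> (real ^ 't) \<times> real \<Rightarrow> (real ^ 's) \<times> (real ^ 't)" where
  "potentials \<eta> = (\<lambda>(l, b, \<kappa>).
     ((\<chi> i. - (l $ i) / \<eta> - 1/2 + (\<kappa> / \<eta> - 1/2)),
      (\<chi> j. - (b $ j) / \<eta> - 1/2 - (\<kappa> / \<eta> - 1/2))))"

end

theory Submission
  imports Defs
begin

text \<open>The Lagrangian is affine in \<open>\<nu>\<close>, so its infimum is \<open>-\<infinity>\<close> unless the coefficient of every
  \<open>\<nu> c\<close> vanishes, and it is separable in \<open>\<gamma>\<close>, where \<open>x * a + \<eta> * (x * ln x)\<close> has minimum
  \<open>- \<eta> * exp (- a / \<eta> - 1)\<close>. A multiplier \<open>\<rho> \<noteq> 0\<close> is never optimal: adding \<open>\<rho> (y i)\<close> to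
  \<open>\<lambda> i\<close> keeps the coefficients of \<open>\<nu>\<close> equal to zero with \<open>\<rho> = 0\<close> and strictly decreases the
  exponentials. Uniqueness is strict convexity in the sums \<open>f i + g j\<close>; these determine \<open>(f, g)\<close>
  up to opposite shifts, and the constraint on \<open>f\<close> fixes the shift.\<close>

section \<open>Scalar estimates for the entropy and the exponential\<close>

text \<open>With \<open>t = exp (- a / \<eta> - 1)\<close> the gap between the two sides is
  \<open>\<eta> * (t - x - x * ln (t / x))\<close> for positive \<open>x\<close>, which is
  nonnegative by \<open>ln u \<le> u - 1\<close> at \<open>u = t / x\<close>.\<close>

lemma entropic_term_ge:
  fixes x a \<eta> :: real
  assumes "0 < \<eta>" "0 \<le> x"
  shows "- \<eta> * exp (- a / \<eta> - 1) \<le> x * a + \<eta> * (x * ln x)"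
proof (cases "x = 0")
  case True
  then show ?thesis using assms by simp
next
  case False
  then have x: "0 < x" using assms by simp
  define t where "t = exp (- a / \<eta> - 1)"
  have t: "0 < t" and a: "a = - \<eta> * (ln t + 1)"
    using assms by (simp_all add: t_def)
  have "ln (t / x) \<le> t / x - 1"
    using x t by (intro ln_le_minus_one) simp
  then have "x * (ln t - ln x) \<le> x * (t / x - 1)"
    using x t by (intro mult_left_mono) (simp_all add: ln_div)
  then have "0 \<le> t - x - x * (ln t - ln x)"
    using x by (simp add: right_diff_distrib)
  then have "0 \<le> \<eta> * (t - x - x * (ln t - ln x))"
    using assms by simp
  then show ?thesis
    unfolding t_def[symmetric] by (simp add: a algebra_simps)
qed

lemma entropic_term_eq:
  fixes a \<eta> :: real
  assumes "0 < \<eta>"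
  shows "exp (- a / \<eta> - 1) * a + \<eta> * (exp (- a / \<eta> - 1) * ln (exp (- a / \<eta> - 1)))
    = - \<eta> * exp (- a / \<eta> - 1)"
  using assms by (simp add: field_simps)

text \<open>The gap is half the square of \<open>exp (a / 2) - exp (b / 2)\<close>, which gives the
  strict case without derivatives.\<close>

lemma exp_midpoint_le:
  fixes a b :: real
  shows "exp ((a + b) / 2) \<le> (exp a + exp b) / 2"
    and "a \<noteq> b \<Longrightarrow> exp ((a + b) / 2) < (exp a + exp b) / 2"
proof -
  have e: "(exp a + exp b) / 2 - exp ((a + b) / 2) = (exp (a / 2) - exp (b / 2))\<^sup>2 / 2"
    by (simp add: power2_diff exp_double[symmetric] add_divide_distrib exp_add diff_divide_distrib)
  show "exp ((a + b) / 2) \<le> (exp a + exp b) / 2"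
    using e zero_le_power2[of "exp (a / 2) - exp (b / 2)"] by linarith
  assume "a \<noteq> b"
  then have "0 < (exp (a / 2) - exp (b / 2))\<^sup>2" by simp
  then show "exp ((a + b) / 2) < (exp a + exp b) / 2" using e by linarith
qed

section \<open>Closed form of the dual function\<close>

lemma sum_class_matrix:
  fixes y :: "'s::finite \<Rightarrow> 'c::finite"
  shows "(\<Sum>i\<in>UNIV. class_matrix y $ i $ c) = (if c \<in> range y then 1 else 0)"
proof -
  have "(\<Sum>i\<in>UNIV. class_matrix y $ i $ c) = (\<Sum>i\<in>{i. y i = c}. 1 / real (card {i. y i = c}))"
    by (simp add: class_matrix_def sum.If_cases Int_def)
  also have "\<dots> = (if c \<in> range y then 1 else 0)"
    by auto
  finally show ?thesis .
qed

text \<open>Collecting terms by primal variable separates the infimum: each entry of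
  \<open>\<gamma>\<close> can be minimised on its own, and \<nu> enters linearly.\<close>

lemma lagrangian_primal_eq:
  fixes \<zeta> \<gamma> :: "real ^ 't ^ 's" and y :: "'s::finite \<Rightarrow> 'c::finite"
  shows "lagrangian (primal_cost \<zeta> \<eta>) (primal_eq y \<mu>) primal_ineq (\<gamma>, \<nu>) ((l, b, \<kappa>), \<rho>) =
    (\<Sum>i\<in>UNIV. \<Sum>j\<in>UNIV. \<gamma> $ i $ j * (\<zeta> $ i $ j + l $ i + b $ j)
       + \<eta> * (\<gamma> $ i $ j * ln (\<gamma> $ i $ j)))
    - b \<bullet> \<mu> - \<kappa>
    + (\<Sum>c\<in>UNIV. \<nu> $ c * ((\<Sum>i\<in>UNIV. class_matrix y $ i $ c * (\<kappa> - l $ i)) - \<rho> $ c))"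
proof -
  have l: "l \<bullet> (\<gamma> *v 1) = (\<Sum>i\<in>UNIV. \<Sum>j\<in>UNIV. \<gamma> $ i $ j * l $ i)"
    by (simp add: inner_vec_def matrix_vector_mult_def sum_distrib_left mult.commute)
  have "b \<bullet> (transpose \<gamma> *v 1) = (\<Sum>j\<in>UNIV. \<Sum>i\<in>UNIV. \<gamma> $ i $ j * b $ j)"
    by (simp add: inner_vec_def matrix_vector_mult_def transpose_def sum_distrib_left mult.commute)
  also have "\<dots> = (\<Sum>i\<in>UNIV. \<Sum>j\<in>UNIV. \<gamma> $ i $ j * b $ j)"
    by (rule sum.swap)
  finally have b: "b \<bullet> (transpose \<gamma> *v 1) = (\<Sum>i\<in>UNIV. \<Sum>j\<in>UNIV. \<gamma> $ i $ j * b $ j)" .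
  have "l \<bullet> (class_matrix y *v \<nu>)
      = (\<Sum>i\<in>UNIV. \<Sum>c\<in>UNIV. \<nu> $ c * (class_matrix y $ i $ c * l $ i))"
    by (simp add: inner_vec_def matrix_vector_mult_def sum_distrib_left mult_ac)
  also have "\<dots> = (\<Sum>c\<in>UNIV. \<Sum>i\<in>UNIV. \<nu> $ c * (class_matrix y $ i $ c * l $ i))"
    by (rule sum.swap)
  finally have D: "l \<bullet> (class_matrix y *v \<nu>)
      = (\<Sum>c\<in>UNIV. \<nu> $ c * (\<Sum>i\<in>UNIV. class_matrix y $ i $ c * l $ i))"
    by (simp add: sum_distrib_left)
  have k: "\<kappa> * (\<Sum>c\<in>UNIV. \<Sum>i\<in>UNIV. class_matrix y $ i $ c * \<nu> $ c)
      = (\<Sum>c\<in>UNIV. \<nu> $ c * (\<Sum>i\<in>UNIV. class_matrix y $ i $ c * \<kappa>))"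
    by (simp add: sum_distrib_left mult_ac)
  have r: "\<rho> \<bullet> (- \<nu>) = - (\<Sum>c\<in>UNIV. \<nu> $ c * \<rho> $ c)"
    by (simp add: inner_vec_def sum_negf mult.commute)
  have c: "primal_cost \<zeta> \<eta> (\<gamma>, \<nu>) = (\<Sum>i\<in>UNIV. \<Sum>j\<in>UNIV. \<gamma> $ i $ j * \<zeta> $ i $ j)
     + (\<Sum>i\<in>UNIV. \<Sum>j\<in>UNIV. \<eta> * (\<gamma> $ i $ j * ln (\<gamma> $ i $ j)))"
    by (simp add: primal_cost_def frobenius_def entropy_def sum_distrib_left mult.commute)
  show ?thesis
    unfolding lagrangian_def primal_eq_def primal_ineq_def prod.case inner_Pair inner_real_def
      inner_diff_right l b D c r right_diff_distrib sum_subtractf k distrib_left sum.distrib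
    by simp
qed

lemma dual_fun_eq:
  fixes \<zeta> :: "real ^ 't ^ 's" and y :: "'s::finite \<Rightarrow> 'c::finite"
  assumes "0 < \<eta>"
  shows "dual_fun \<zeta> \<eta> y \<mu> ((l, b, \<kappa>), \<rho>) =
    (if \<forall>c. (\<Sum>i\<in>UNIV. class_matrix y $ i $ c * (\<kappa> - l $ i)) = \<rho> $ c
     then ereal (- \<eta> * (\<Sum>i\<in>UNIV. \<Sum>j\<in>UNIV. exp (- (\<zeta> $ i $ j + l $ i + b $ j) / \<eta> - 1))
            - b \<bullet> \<mu> - \<kappa>)
     else - \<infinity>)"
proof -
  let ?L = "\<lambda>x. lagrangian (primal_cost \<zeta> \<eta>) (primal_eq y \<mu>) primal_ineq x ((l, b, \<kappa>), \<rho>)"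
  define e where "e c = (\<Sum>i\<in>UNIV. class_matrix y $ i $ c * (\<kappa> - l $ i)) - \<rho> $ c" for c
  \<comment> \<open>The entrywise minimiser. It does not depend on \<nu>, so it attains the infimum
    when all \<open>e c\<close> vanish and also serves as the base point of the unbounded direction
    otherwise.\<close>
  define \<gamma> :: "real ^ 't ^ 's"
    where "\<gamma> = (\<chi> i j. exp (- (\<zeta> $ i $ j + l $ i + b $ j) / \<eta> - 1))"
  define V where
    "V = - \<eta> * (\<Sum>i\<in>UNIV. \<Sum>j\<in>UNIV. exp (- (\<zeta> $ i $ j + l $ i + b $ j) / \<eta> - 1)) - b \<bullet> \<mu> - \<kappa>"
  have dom: "(\<gamma>, \<nu>) \<in> primal_domain" for \<nu> :: "real ^ 'c"
    by (simp add: primal_domain_def \<gamma>_def less_eq_vec_def)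
  have at: "?L (\<gamma>, \<nu>) = V + (\<Sum>c\<in>UNIV. \<nu> $ c * e c)" for \<nu>
  proof -
    have "?L (\<gamma>, \<nu>) = (\<Sum>i\<in>UNIV. \<Sum>j\<in>UNIV. - \<eta> * exp (- (\<zeta> $ i $ j + l $ i + b $ j) / \<eta> - 1))
        - b \<bullet> \<mu> - \<kappa> + (\<Sum>c\<in>UNIV. \<nu> $ c * e c)"
      unfolding lagrangian_primal_eq \<gamma>_def e_def vec_lambda_beta entropic_term_eq[OF assms] ..
    then show ?thesis by (simp add: V_def sum_distrib_left sum_negf)
  qed
  have Q: "dual_fun \<zeta> \<eta> y \<mu> ((l, b, \<kappa>), \<rho>) = (INF x\<in>primal_domain. ereal (?L x))"
    by (simp add: dual_fun_def lagrange_dual_def)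
  show ?thesis
  proof (cases "\<forall>c. e c = 0")
    case True
    have "(INF x\<in>primal_domain. ereal (?L x)) = ereal V"
    proof (rule antisym)
      show "(INF x\<in>primal_domain. ereal (?L x)) \<le> ereal V"
        using INF_lower[OF dom[of 0], of "\<lambda>x. ereal (?L x)"] by (simp add: at)
      show "ereal V \<le> (INF x\<in>primal_domain. ereal (?L x))"
      proof (rule INF_greatest, clarify)
        fix \<gamma>' :: "real ^ 't ^ 's" and \<nu> :: "real ^ 'c"
        assume "(\<gamma>', \<nu>) \<in> primal_domain"
        then have pos: "0 \<le> \<gamma>' $ i $ j" for i j
          by (simp add: primal_domain_def less_eq_vec_def)
        have "(\<Sum>i\<in>UNIV. \<Sum>j\<in>UNIV. - \<eta> * exp (- (\<zeta> $ i $ j + l $ i + b $ j) / \<eta> - 1))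
          \<le> (\<Sum>i\<in>UNIV. \<Sum>j\<in>UNIV. \<gamma>' $ i $ j * (\<zeta> $ i $ j + l $ i + b $ j)
              + \<eta> * (\<gamma>' $ i $ j * ln (\<gamma>' $ i $ j)))"
          by (intro sum_mono entropic_term_ge assms pos)
        then show "ereal V \<le> ereal (?L (\<gamma>', \<nu>))"
          unfolding lagrangian_primal_eq e_def[symmetric]
          using True by (simp add: V_def sum_distrib_left sum_negf)
      qed
    qed
    then show ?thesis using True Q by (simp add: e_def V_def)
  next
    case False
    then obtain c where c: "e c \<noteq> 0" by blast
    have "(INF x\<in>primal_domain. ereal (?L x)) \<le> ereal B" for B
    proof -
      \<comment> \<open>Moving only the coordinate \<open>c\<close> adds \<open>B - V\<close> to the
        value \<open>V\<close>, so the Lagrangian equals the prescribed bound \<open>B\<close>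
        exactly.\<close>
      let ?\<nu> = "(\<chi> k. if k = c then (B - V) / e c else 0) :: real ^ 'c"
      have "(\<Sum>k\<in>UNIV. ?\<nu> $ k * e k) = (\<Sum>k\<in>UNIV. if k = c then B - V else 0)"
        using c by (intro sum.cong) auto
      then have "?L (\<gamma>, ?\<nu>) = B" by (simp add: at)
      then show ?thesis
        using INF_lower[OF dom[of ?\<nu>], of "\<lambda>x. ereal (?L x)"] by simp
    qed
    then have "(INF x\<in>primal_domain. ereal (?L x)) = - \<infinity>"
      by (rule ereal_bot)
    then show ?thesis using False Q by (auto simp: e_def)
  qed
qed

section \<open>The change of variables\<close>

lemma fg_objective_eq:
  "fg_objective \<zeta> \<eta> y \<mu> (f, g) =
    (if f \<in> potential_set y
     then ereal ((\<Sum>i\<in>UNIV. \<Sum>j\<in>UNIV. exp (f $ i + g $ j - \<zeta> $ i $ j / \<eta>)) - g \<bullet> \<mu>) else \<infinity>)"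
proof -
  have "1 \<bullet> (scaled_kernel \<zeta> \<eta> f g *v 1)
      = (\<Sum>i\<in>UNIV. \<Sum>j\<in>UNIV. exp (f $ i + g $ j - \<zeta> $ i $ j / \<eta>))"
    by (simp add: inner_vec_def matrix_vector_mult_def scaled_kernel_def flip: exp_add)
      (simp add: algebra_simps)
  then show ?thesis
    by (simp add: fg_objective_def chi_fun_def)
qed

lemma feasible_set_primal:
  "feasible_set primal_domain (primal_eq y \<mu>) primal_ineq = primal_set y \<mu>"
  by (auto simp: feasible_set_def primal_domain_def primal_eq_def primal_ineq_def primal_set_def
      class_proportions_def couplings_def zero_prod_def less_eq_vec_def)

text \<open>The shifts are chosen so that \<open>f $ i + 1 = (\<kappa> - l $ i) / \<eta>\<close>,
  which turns the coefficient condition into membership in \<open>potential_set y\<close>. They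
  cancel in \<open>f $ i + g $ j\<close>, leaving the exponent of the dual. Since \<mu> has total
  mass 1, the shift of \<open>g\<close> contributes exactly the term in \<kappa>. Outside
  \<open>potential_set y\<close> both sides are minus infinity.\<close>

lemma dual_fun_potentials:
  fixes \<zeta> :: "real ^ 't ^ 's" and y :: "'s::finite \<Rightarrow> 'c::finite"
  assumes "0 < \<eta>" and "\<mu> \<in> prob_simplex"
  shows "dual_fun \<zeta> \<eta> y \<mu> (m, 0) = ereal (- \<eta>) * fg_objective \<zeta> \<eta> y \<mu> (potentials \<eta> m)"
proof -
  obtain l b \<kappa> where m: "m = (l, b, \<kappa>)" by (cases m)
  define f :: "real ^ 's" where "f = (\<chi> i. - (l $ i) / \<eta> - 1/2 + (\<kappa> / \<eta> - 1/2))"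
  define g :: "real ^ 't" where "g = (\<chi> j. - (b $ j) / \<eta> - 1/2 - (\<kappa> / \<eta> - 1/2))"
  have p: "potentials \<eta> m = (f, g)" by (simp add: m potentials_def f_def g_def)
  have "(\<Sum>i\<in>UNIV. (f $ i + 1) * class_matrix y $ i $ c)
      = (\<Sum>i\<in>UNIV. class_matrix y $ i $ c * (\<kappa> - l $ i)) / \<eta>" for c
    unfolding sum_divide_distrib f_def
    by (intro sum.cong) (simp_all add: diff_divide_distrib algebra_simps)
  then have F: "f \<in> potential_set y
      \<longleftrightarrow> (\<forall>c. (\<Sum>i\<in>UNIV. class_matrix y $ i $ c * (\<kappa> - l $ i)) = (0 :: real ^ 'c) $ c)"
    using assms by (simp add: potential_set_def)
  have e: "exp (f $ i + g $ j - \<zeta> $ i $ j / \<eta>) = exp (- (\<zeta> $ i $ j + l $ i + b $ j) / \<eta> - 1)" for i j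
    by (simp add: f_def g_def add_divide_distrib diff_divide_distrib)
  have "g \<bullet> \<mu> = (\<Sum>j\<in>UNIV. - (b $ j * \<mu> $ j) / \<eta> - \<kappa> / \<eta> * \<mu> $ j)"
    unfolding inner_vec_def g_def by (intro sum.cong) (simp_all add: algebra_simps)
  also have "\<dots> = - (b \<bullet> \<mu>) / \<eta> - \<kappa> / \<eta> * (\<Sum>j\<in>UNIV. \<mu> $ j)"
    by (simp add: inner_vec_def sum_subtractf sum_divide_distrib sum_distrib_left sum_negf)
  finally have g: "\<eta> * (g \<bullet> \<mu>) = - (b \<bullet> \<mu>) - \<kappa>"
    using assms by (simp add: prob_simplex_def field_simps)
  show ?thesis
    unfolding p fg_objective_eq e F
    unfolding m dual_fun_eq[OF assms(1)]
    using assms g by (simp add: algebra_simps)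
qed

lemma potentials_surj:
  assumes "\<eta> \<noteq> 0"
  shows "\<exists>m. potentials \<eta> m = p"
proof -
  obtain f g where p: "p = (f, g)" by (cases p)
  \<comment> \<open>At \<open>\<kappa> = 0\<close> the map reduces to
    \<open>f = - l / \<eta> - 1\<close> and \<open>g = - b / \<eta>\<close>, solved here for
    \<open>l\<close> and \<open>b\<close>.\<close>
  have "potentials \<eta> ((\<chi> i. - \<eta> * (f $ i + 1)), (\<chi> j. - \<eta> * g $ j), 0) = p"
    using assms by (simp add: potentials_def p vec_eq_iff)
  then show ?thesis by blast
qed

section \<open>Elimination of the sign multiplier\<close>

lemma dual_fun_less:
  fixes \<zeta> :: "real ^ 't ^ 's" and y :: "'s::finite \<Rightarrow> 'c::finite"
  assumes "0 < \<eta>" "0 \<le> \<rho>" "\<rho> \<noteq> 0"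
  shows "\<exists>m'. dual_fun \<zeta> \<eta> y \<mu> (m, \<rho>) < dual_fun \<zeta> \<eta> y \<mu> (m', 0)"
proof -
  obtain l b \<kappa> where m: "m = (l, b, \<kappa>)" by (cases m)
  show ?thesis
  proof (cases "\<forall>c. (\<Sum>i\<in>UNIV. class_matrix y $ i $ c * (\<kappa> - l $ i)) = \<rho> $ c")
    case False
    then have "dual_fun \<zeta> \<eta> y \<mu> (m, \<rho>) = - \<infinity>"
      unfolding m dual_fun_eq[OF assms(1)] by simp
    \<comment> \<open>Zero multipliers satisfy the coefficient condition, so their dual value is
      finite.\<close>
    moreover have "- \<infinity> < dual_fun \<zeta> \<eta> y \<mu> ((0, 0, 0), 0)"
      unfolding dual_fun_eq[OF assms(1)] by simp
    ultimately show ?thesis by metis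
  next
    case True
    define l' where "l' = (\<chi> i. l $ i + \<rho> $ (y i))"
    have \<rho>: "0 \<le> \<rho> $ c" for c using assms by (simp add: less_eq_vec_def)
    \<comment> \<open>A class without source points has a zero column, so the coefficient condition
      forces its entry of \<rho> to vanish. Hence every nonzero entry belongs to the class of some
      source point, whose row of exponentials then drops strictly.\<close>
    have empty: "\<rho> $ c = 0" if "c \<notin> range y" for c
    proof -
      have "class_matrix y $ i $ c = 0" for i using that by (auto simp: class_matrix_def)
      then show ?thesis using True[rule_format, of c] by simp
    qed
    have F: "(\<Sum>i\<in>UNIV. class_matrix y $ i $ c * (\<kappa> - l' $ i)) = (0 :: real ^ 'c) $ c" for c
    proof -
      have "(\<Sum>i\<in>UNIV. class_matrix y $ i $ c * (\<kappa> - l' $ i))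
        = (\<Sum>i\<in>UNIV. class_matrix y $ i $ c * (\<kappa> - l $ i) - class_matrix y $ i $ c * \<rho> $ c)"
        by (intro sum.cong) (auto simp: l'_def class_matrix_def algebra_simps)
      also have "\<dots> = \<rho> $ c - (\<Sum>i\<in>UNIV. class_matrix y $ i $ c) * \<rho> $ c"
        by (simp only: sum_subtractf True[rule_format] sum_distrib_right)
      \<comment> \<open>The column sum is 1 for an inhabited class; for any other class
        \<open>\<rho> $ c\<close> is already 0.\<close>
      also have "\<dots> = 0" by (simp add: sum_class_matrix empty)
      finally show ?thesis by simp
    qed
    obtain c where "\<rho> $ c \<noteq> 0" using assms by (auto simp: vec_eq_iff)
    then obtain i where i: "\<rho> $ (y i) \<noteq> 0" using empty by force
    let ?S = "\<lambda>l. \<Sum>i\<in>UNIV. \<Sum>j\<in>UNIV. exp (- (\<zeta> $ i $ j + l $ i + b $ j) / \<eta> - 1)"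
    have "?S l' < ?S l"
    proof (rule sum_strict_mono_ex1)
      show "\<forall>i\<in>UNIV. (\<Sum>j\<in>UNIV. exp (- (\<zeta> $ i $ j + l' $ i + b $ j) / \<eta> - 1))
          \<le> (\<Sum>j\<in>UNIV. exp (- (\<zeta> $ i $ j + l $ i + b $ j) / \<eta> - 1))"
        using assms \<rho> by (auto intro!: sum_mono divide_right_mono simp: l'_def)
      have "0 < \<rho> $ (y i)" using \<rho>[of "y i"] i by linarith
      then have "(\<Sum>j\<in>UNIV. exp (- (\<zeta> $ i $ j + l' $ i + b $ j) / \<eta> - 1))
          < (\<Sum>j\<in>UNIV. exp (- (\<zeta> $ i $ j + l $ i + b $ j) / \<eta> - 1))"
        using assms by (intro sum_strict_mono) (auto simp: l'_def intro!: divide_strict_right_mono)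
      then show "\<exists>i\<in>UNIV. (\<Sum>j\<in>UNIV. exp (- (\<zeta> $ i $ j + l' $ i + b $ j) / \<eta> - 1))
          < (\<Sum>j\<in>UNIV. exp (- (\<zeta> $ i $ j + l $ i + b $ j) / \<eta> - 1))"
        by blast
    qed simp
    then have "dual_fun \<zeta> \<eta> y \<mu> (m, \<rho>) < dual_fun \<zeta> \<eta> y \<mu> ((l', b, \<kappa>), 0)"
      unfolding m dual_fun_eq[OF assms(1)] using True F assms by simp
    then show ?thesis by blast
  qed
qed

section \<open>Uniqueness of the optimal potentials\<close>

lemma fg_arg_min_unique:
  fixes \<zeta> :: "real ^ 't ^ 's" and y :: "'s::finite \<Rightarrow> 'c::finite"
  assumes "is_arg_min (fg_objective \<zeta> \<eta> y \<mu>) (\<lambda>p. True) p"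
    and "is_arg_min (fg_objective \<zeta> \<eta> y \<mu>) (\<lambda>p. True) q"
  shows "p = q"
proof -
  let ?F = "fg_objective \<zeta> \<eta> y \<mu>"
  obtain f g f' g' where pq: "p = (f, g)" "q = (f', g')" by (cases p, cases q)
  have le: "?F p \<le> ?F r" "?F q \<le> ?F r" for r
    using assms unfolding is_arg_min_def not_less[symmetric] by blast+
  \<comment> \<open>The constant -1 annihilates every factor \<open>f $ i + 1\<close>, so it
    satisfies the constraint; minimisers therefore have finite values and satisfy it too.\<close>
  have "?F ((\<chi> i. - 1), 0) < \<infinity>"
    by (simp add: fg_objective_eq potential_set_def)
  then have "?F p < \<infinity>" "?F q < \<infinity>" using le order.strict_trans1 by blast+
  then have f: "f \<in> potential_set y" "f' \<in> potential_set y"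
    unfolding pq by (auto simp: fg_objective_eq split: if_splits)
  define fm where "fm = (\<chi> i. (f $ i + f' $ i) / 2)"
  define gm where "gm = (\<chi> j. (g $ j + g' $ j) / 2)"
  have "(\<Sum>i\<in>UNIV. (fm $ i + 1) * class_matrix y $ i $ c)
      = ((\<Sum>i\<in>UNIV. (f $ i + 1) * class_matrix y $ i $ c)
        + (\<Sum>i\<in>UNIV. (f' $ i + 1) * class_matrix y $ i $ c)) / 2" for c
    unfolding sum.distrib[symmetric] sum_divide_distrib
    by (intro sum.cong) (simp_all add: fm_def field_simps)
  then have fm: "fm \<in> potential_set y" using f by (simp add: potential_set_def)
  let ?E = "\<lambda>f g i j. exp (f $ i + g $ j - \<zeta> $ i $ j / \<eta>)"
  let ?S = "\<lambda>f g. \<Sum>i\<in>UNIV. \<Sum>j\<in>UNIV. ?E f g i j"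
  have "?S f g - g \<bullet> \<mu> \<le> ?S fm gm - gm \<bullet> \<mu>" "?S f' g' - g' \<bullet> \<mu> \<le> ?S fm gm - gm \<bullet> \<mu>"
    using le[of "(fm, gm)"] f fm unfolding pq fg_objective_eq by auto
  moreover have "gm \<bullet> \<mu> = (g \<bullet> \<mu> + g' \<bullet> \<mu>) / 2"
    unfolding inner_vec_def sum.distrib[symmetric] sum_divide_distrib
    by (intro sum.cong) (simp_all add: gm_def field_simps)
  \<comment> \<open>Averaging the two minimality inequalities cancels the linear terms at the
    midpoint, so only the exponential sums remain to be compared.\<close>
  moreover have "(s + s') / 2 \<le> r"
    if "s - a \<le> r - m" "s' - a' \<le> r - m" "m = (a + a') / 2" for s s' r a a' m :: real
    using that by (simp add: field_simps)
  ultimately have ge: "(?S f g + ?S f' g') / 2 \<le> ?S fm gm" by blast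
  have mid: "?E fm gm i j
      = exp ((f $ i + g $ j - \<zeta> $ i $ j / \<eta> + (f' $ i + g' $ j - \<zeta> $ i $ j / \<eta>)) / 2)" for i j
    by (simp add: fm_def gm_def field_simps)
  have mid_le: "?E fm gm i j \<le> (?E f g i j + ?E f' g' i j) / 2" for i j
    unfolding mid by (rule exp_midpoint_le(1))
  have half: "(?S f g + ?S f' g') / 2 = (\<Sum>i\<in>UNIV. \<Sum>j\<in>UNIV. (?E f g i j + ?E f' g' i j) / 2)"
    by (simp only: add_divide_distrib sum.distrib sum_divide_distrib)
  have eq: "f $ i + g $ j = f' $ i + g' $ j" for i j
  proof (rule ccontr)
    assume neq: "f $ i + g $ j \<noteq> f' $ i + g' $ j"
    have less: "?E fm gm i j < (?E f g i j + ?E f' g' i j) / 2"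
      unfolding mid using neq by (intro exp_midpoint_le(2)) simp
    have less': "(\<Sum>j\<in>UNIV. ?E fm gm i j) < (\<Sum>j\<in>UNIV. (?E f g i j + ?E f' g' i j) / 2)"
      by (rule sum_strict_mono_ex1[OF finite]) (use less mid_le in blast)+
    have "?S fm gm < (\<Sum>i\<in>UNIV. \<Sum>j\<in>UNIV. (?E f g i j + ?E f' g' i j) / 2)"
      by (rule sum_strict_mono_ex1[OF finite])
        (use less' in \<open>blast intro: sum_mono mid_le\<close>)+
    then show False using ge half by linarith
  qed
  \<comment> \<open>Index types are nonempty, so \<open>undefined\<close> serves as an arbitrary
    target index; equality of all sums makes the shift the same for every \<open>i\<close>.\<close>
  define t where "t = g' $ undefined - g $ undefined"
  have ft: "f $ i = f' $ i + t" for i using eq[of i undefined] by (simp add: t_def)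
  have "(\<Sum>i\<in>UNIV. (f $ i + 1) * class_matrix y $ i $ c)
      = (\<Sum>i\<in>UNIV. (f' $ i + 1) * class_matrix y $ i $ c) + t * (\<Sum>i\<in>UNIV. class_matrix y $ i $ c)"
    for c by (simp add: ft sum_distrib_left sum.distrib[symmetric] algebra_simps)
  \<comment> \<open>The class of an actual source point has column sum 1, so subtracting its two
    constraints leaves \<open>t\<close> alone.\<close>
  from this[of "y undefined"] have "t = 0"
    using f by (simp add: potential_set_def sum_class_matrix)
  then show ?thesis
    using ft eq by (simp add: pq vec_eq_iff)
qed

section \<open>Sign reversal in the extended reals and transfer of optima\<close>

lemma ereal_uminus_mult_less_iff:
  assumes "0 < c"
  shows "ereal (- c) * x < ereal (- c) * z \<longleftrightarrow> z < x"
  using assms by (cases x; cases z) auto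

lemma SUP_ereal_uminus_mult:
  assumes "0 < c"
  shows "(SUP i\<in>I. ereal (- c) * f i) = ereal (- c) * (INF i\<in>I. f i)"
proof -
  have "ereal (- c) * x = - (ereal c * x)" for x
    by (cases x) auto
  moreover have "(INF i\<in>I. ereal c * f i) = ereal c * (INF i\<in>I. f i)"
    using ereal_Inf_cmult[OF assms, of "\<lambda>x. x \<in> f ` I"] by (simp add: image_image Setcompr_eq_image)
  ultimately show ?thesis by (simp add: ereal_SUP_uminus_eq)
qed

(* The conjuncts: the dualised constraints describe the primal problem; pointwise identity of the
   dual objectives after the change of variables; optimal values; optimal solutions; the arg min
   contains at most one pair. *)
theorem lemma3:
  fixes \<zeta> :: "real ^ 't ^ 's" and \<eta> :: real
    and y :: "'s::finite \<Rightarrow> 'c::finite" and \<mu> :: "real ^ 't"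
  assumes "0 \<le> \<zeta>" and "0 < \<eta>" and "\<mu> \<in> prob_simplex"
  shows
    "feasible_set primal_domain (primal_eq y \<mu>) primal_ineq = primal_set y \<mu> \<and>
     (\<forall>m. dual_fun \<zeta> \<eta> y \<mu> (m, 0)
            = ereal (- \<eta>) * fg_objective \<zeta> \<eta> y \<mu> (potentials \<eta> m)) \<and>
     (SUP m\<in>Collect dual_feasible. dual_fun \<zeta> \<eta> y \<mu> m)
       = ereal (- \<eta>) * (INF p. fg_objective \<zeta> \<eta> y \<mu> p) \<and>
     (\<forall>m \<rho>. is_arg_max (dual_fun \<zeta> \<eta> y \<mu>) dual_feasible (m, \<rho>) \<longleftrightarrow>
       \<rho> = 0 \<and> is_arg_min (fg_objective \<zeta> \<eta> y \<mu>) (\<lambda>p. True) (potentials \<eta> m)) \<and>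
     (\<forall>p q. is_arg_min (fg_objective \<zeta> \<eta> y \<mu>) (\<lambda>p. True) p \<longrightarrow>
       is_arg_min (fg_objective \<zeta> \<eta> y \<mu>) (\<lambda>p. True) q \<longrightarrow> p = q)"
proof -
  let ?Q = "dual_fun \<zeta> \<eta> y \<mu>" and ?F = "fg_objective \<zeta> \<eta> y \<mu>"
  note Q0 = dual_fun_potentials[OF assms(2,3), of \<zeta> y]
  have \<eta>: "\<eta> \<noteq> 0" using assms by simp
  have feas0: "dual_feasible (m, 0 :: real ^ 'c)"
    for m :: "(real ^ 's) \<times> (real ^ 't) \<times> real"
    by (simp add: dual_feasible_def)
  have less: "\<exists>m'. ?Q (m, \<rho>) < ?Q (m', 0)" if "dual_feasible (m, \<rho>)" "\<rho> \<noteq> 0" for m \<rho>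
    using dual_fun_less[OF assms(2)] that by (simp add: dual_feasible_def)
  \<comment> \<open>Every feasible multiplier is dominated by one with \<rho> zero, so suprema and
    maximality can be tested on that slice.\<close>
  have le: "\<exists>m'. ?Q (m, \<rho>) \<le> ?Q (m', 0)" if "dual_feasible (m, \<rho>)" for m \<rho>
    using less[OF that] by (cases "\<rho> = 0") (blast intro: less_imp_le)+
  have "(SUP m\<in>Collect dual_feasible. ?Q m) = (SUP m. ?Q (m, 0))"
    using le feas0 by (intro antisym SUP_mono) (auto, blast+)
  also have "\<dots> = ereal (- \<eta>) * (INF m. ?F (potentials \<eta> m))"
    unfolding Q0 by (rule SUP_ereal_uminus_mult[OF assms(2)])
  also have "(INF m. ?F (potentials \<eta> m)) = (INF p. ?F p)"
  proof -
    \<comment> \<open>Surjectivity turns the infimum over multipliers into one over all pairs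
      \<open>(f, g)\<close>.\<close>
    have "range (potentials \<eta>) = UNIV"
      using potentials_surj[OF \<eta>] by (metis surjI surj_def)
    then show ?thesis by (metis image_image)
  qed
  finally have sup: "(SUP m\<in>Collect dual_feasible. ?Q m) = ereal (- \<eta>) * (INF p. ?F p)" .
  have arg: "is_arg_max ?Q dual_feasible (m, \<rho>) \<longleftrightarrow>
      \<rho> = 0 \<and> is_arg_min ?F (\<lambda>p. True) (potentials \<eta> m)" for m \<rho>
  proof (cases "\<rho> = 0")
    case False
    then show ?thesis using less feas0 unfolding is_arg_max_def by blast
  next
    case True
    have "is_arg_max ?Q dual_feasible (m, 0) \<longleftrightarrow> \<not> (\<exists>m'. ?Q (m, 0) < ?Q (m', 0))"
      using le feas0 by (auto simp: is_arg_max_def) (meson order.strict_trans2)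
    also have "\<dots> \<longleftrightarrow> \<not> (\<exists>m'. ?F (potentials \<eta> m') < ?F (potentials \<eta> m))"
      unfolding Q0 ereal_uminus_mult_less_iff[OF assms(2)] ..
    also have "\<dots> \<longleftrightarrow> is_arg_min ?F (\<lambda>p. True) (potentials \<eta> m)"
      using potentials_surj[OF \<eta>] by (metis is_arg_min_def)
    finally show ?thesis using True by simp
  qed
  show ?thesis
    using feasible_set_primal Q0 sup arg fg_arg_min_unique by blast
qed

end
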